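(* Let $\beta \ge 3$ be an integer. The packing density of $\tau_{2,\beta}$ is $$\rho(\tau_{2,\beta}) = \binom{\beta+2}{2}\left(\frac{2}{\beta+2}\right)^2\left(\frac{\beta}{\beta+2}\right)^{\beta}.$$
   Context: Permutations are written in one-line notation. For $\sigma \in S_n$ and a pattern $\tau \in S_m$ with $m \le n$, an occurrence of $\tau$ in $\sigma$ is an $m$-subset $S \subseteq \{1,\dots,n\}$ such that the restriction of $\sigma$ to $S$ is order-isomorphic to $\tau$. Let $g(\tau,\sigma)$ be the number of occurrences of $\tau$ in $\sigma$, and let $g(\tau,n) = \max_{\sigma \in S_n} g(\tau,\sigma)$. The sequence $\left(g(\tau,n)/\binom{n}{m}\right)_{n \ge m}$ is known to be nonincreasing in $n$, hence convergent; its limit $\rho(\tau) = \lim_{n\to\infty} g(\tau,n)/\binom{n}{m}$ is called the packing density of $\tau$. The pattern $\tau_{2,\beta} \in S_{\beta+2}$ is $[1,2,\beta+2,\beta+1,\dots,3]$, i.e. the layered permutation with layer sizes $(1,1,\beta)$. *)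

theory Defs
  imports "HOL-Analysis.Analysis" "HOL-Combinatorics.Multiset_Permutations"
begin

text \<open>
  Permutations of \<open>{1..n}\<close> are lists in one-line notation, so the symmetric group \<open>S\<^sub>n\<close> is
  \<^term>\<open>permutations_of_set {1..n}\<close>. Values are 1-based; positions are 0-based, as for all lists.
\<close>

definition order_isomorphic :: "nat list \<Rightarrow> nat list \<Rightarrow> bool" where
  "order_isomorphic xs ys \<longleftrightarrow> length xs = length ys \<and>
     (\<forall>i<length xs. \<forall>j<length xs. xs ! i < xs ! j \<longleftrightarrow> ys ! i < ys ! j)"

definition occurrences :: "nat list \<Rightarrow> nat list \<Rightarrow> nat set set" where
  "occurrences \<tau> \<sigma> =
     {S. S \<subseteq> {..<length \<sigma>} \<and> card S = length \<tau> \<and> order_isomorphic (nths \<sigma> S) \<tau>}"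

definition num_occurrences :: "nat list \<Rightarrow> nat list \<Rightarrow> nat" where
  "num_occurrences \<tau> \<sigma> = card (occurrences \<tau> \<sigma>)"

definition max_occurrences :: "nat list \<Rightarrow> nat \<Rightarrow> nat" where
  "max_occurrences \<tau> n = Max (num_occurrences \<tau> ` permutations_of_set {1..n})"

definition packing_ratio :: "nat list \<Rightarrow> nat \<Rightarrow> real" where
  "packing_ratio \<tau> n = real (max_occurrences \<tau> n) / real (n choose length \<tau>)"

text \<open>The limit exists for every \<open>\<tau>\<close>: see \<open>packing_ratio_LIMSEQ\<close> below.\<close>

definition packing_density :: "nat list \<Rightarrow> real" where
  "packing_density \<tau> = lim (packing_ratio \<tau>)"

definition tau2 :: "nat \<Rightarrow> nat list" where
  "tau2 \<beta> = [1, 2] @ rev [3..<\<beta> + 3]"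

lemma tau2_in_permutations: "tau2 \<beta> \<in> permutations_of_set {1..\<beta> + 2}"
  by (auto simp: tau2_def permutations_of_set_def)

lemma finite_occurrences: "finite (occurrences \<tau> \<sigma>)"
  by (rule finite_subset[of _ "Pow {..<length \<sigma>}"]) (auto simp: occurrences_def)

lemma num_occurrences_le_max:
  assumes "\<sigma> \<in> permutations_of_set {1..n}"
  shows "num_occurrences \<tau> \<sigma> \<le> max_occurrences \<tau> n"
  unfolding max_occurrences_def using assms by (intro Max_ge) auto

lemma max_occurrences_attained:
  obtains \<sigma> where "\<sigma> \<in> permutations_of_set {1..n}" "num_occurrences \<tau> \<sigma> = max_occurrences \<tau> n"
proof -
  have "permutations_of_set {1..n} \<noteq> {}"
    by simp
  then have "max_occurrences \<tau> n \<in> num_occurrences \<tau> ` permutations_of_set {1..n}"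
    unfolding max_occurrences_def by (intro Max_in) auto
  then show ?thesis
    using that by auto
qed

lemma order_isomorphic_map:
  assumes "\<And>x y. x \<in> set xs \<Longrightarrow> y \<in> set xs \<Longrightarrow> f x < f y \<longleftrightarrow> x < y"
  shows "order_isomorphic (map f xs) ys \<longleftrightarrow> order_isomorphic xs ys"
  using assms by (auto simp: order_isomorphic_def)

lemma num_occurrences_distinct_le_max:
  assumes "distinct xs"
  shows "num_occurrences \<tau> xs \<le> max_occurrences \<tau> (length xs)"
proof -
  define f where "f x = card {y \<in> set xs. y \<le> x}" for x
  have less: "f x < f y" if "y \<in> set xs" "x < y" for x y
  proof -
    have "y \<in> {z \<in> set xs. z \<le> y} - {z \<in> set xs. z \<le> x}"
      using that by simp
    then have "{z \<in> set xs. z \<le> x} \<subset> {z \<in> set xs. z \<le> y}"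
      using that(2) by fastforce
    then show ?thesis
      unfolding f_def by (intro psubset_card_mono) auto
  qed
  have iff: "f x < f y \<longleftrightarrow> x < y" if "x \<in> set xs" "y \<in> set xs" for x y
    using less[of x y] less[of y x] that by (cases x y rule: linorder_cases) auto
  have inj: "inj_on f (set xs)"
    by (rule inj_onI) (metis iff less_irrefl linorder_neqE_nat)
  have "f x \<in> {1..length xs}" if "x \<in> set xs" for x
  proof -
    have "f x \<le> card (set xs)"
      unfolding f_def by (intro card_mono) auto
    moreover have "0 < f x"
      unfolding f_def using that by (auto simp: card_gt_0_iff)
    ultimately show ?thesis
      using assms by (simp add: distinct_card)
  qed
  then have "f ` set xs \<subseteq> {1..length xs}"
    by auto
  moreover have "card (f ` set xs) = length xs"
    using inj assms by (simp add: card_image distinct_card)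
  ultimately have "f ` set xs = {1..length xs}"
    by (intro card_subset_eq) auto
  then have perm: "map f xs \<in> permutations_of_set {1..length xs}"
    using inj assms by (auto simp: permutations_of_set_def distinct_map)
  have "order_isomorphic (nths (map f xs) S) \<tau> \<longleftrightarrow> order_isomorphic (nths xs S) \<tau>" for S
    unfolding nths_map by (rule order_isomorphic_map) (auto intro!: iff dest: in_set_nthsD)
  then have "occurrences \<tau> (map f xs) = occurrences \<tau> xs"
    by (simp add: occurrences_def)
  then show ?thesis
    using num_occurrences_le_max[OF perm, of \<tau>] by (simp add: num_occurrences_def)
qed

lemma card_occurrences_within_le:
  assumes "distinct xs" "A \<subseteq> {..<length xs}"
  shows "card {S \<in> occurrences \<tau> xs. S \<subseteq> A} \<le> max_occurrences \<tau> (card A)"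
proof -
  define r where "r i = card {i' \<in> A. i' < i}" for i
  have fin: "finite A"
    using assms(2) finite_subset by blast
  have r_less: "r i < r j" if "i \<in> A" "i < j" for i j
  proof -
    have "i \<in> {i' \<in> A. i' < j} - {i' \<in> A. i' < i}"
      using that by simp
    then have "{i' \<in> A. i' < i} \<subset> {i' \<in> A. i' < j}"
      using that(2) by fastforce
    then show ?thesis
      unfolding r_def using fin by (intro psubset_card_mono) auto
  qed
  have inj: "inj_on r A"
    by (rule inj_onI) (metis r_less less_irrefl linorder_neqE_nat)
  have len: "length (nths xs A) = card A"
  proof -
    have "{i. i < length xs \<and> i \<in> A} = A"
      using assms(2) by auto
    then show ?thesis
      by (simp add: length_nths)
  qed
  have r_bound: "r i < card A" if "i \<in> A" for i
    unfolding r_def using fin that by (intro psubset_card_mono) auto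
  have mem: "r ` S \<in> occurrences \<tau> (nths xs A)" if "S \<in> occurrences \<tau> xs" "S \<subseteq> A" for S
  proof -
    have "{i \<in> A. \<exists>j\<in>r ` S. card {i' \<in> A. i' < i} = j} = S"
      using that(2) inj unfolding r_def[symmetric] inj_on_def by blast
    then have "nths (nths xs A) (r ` S) = nths xs S"
      by (simp add: nths_nths)
    moreover have "card (r ` S) = card S"
      using inj_on_subset[OF inj that(2)] by (rule card_image)
    ultimately show ?thesis
      using that r_bound by (auto simp: occurrences_def len)
  qed
  have "inj_on ((`) r) {S \<in> occurrences \<tau> xs. S \<subseteq> A}"
    by (rule inj_onI) (use inj inj_on_image_eq_iff in blast)
  then have "card {S \<in> occurrences \<tau> xs. S \<subseteq> A} \<le> card (occurrences \<tau> (nths xs A))"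
    using mem by (intro card_inj_on_le[where f = "(`) r"] finite_occurrences) auto
  also have "\<dots> \<le> max_occurrences \<tau> (card A)"
    using num_occurrences_distinct_le_max[of "nths xs A" \<tau>] assms(1) len
    by (simp add: num_occurrences_def distinct_nthsI)
  finally show ?thesis .
qed

lemma max_occurrences_Suc_le:
  "(Suc n - length \<tau>) * max_occurrences \<tau> (Suc n) \<le> Suc n * max_occurrences \<tau> n"
proof -
  obtain \<sigma> where \<sigma>: "\<sigma> \<in> permutations_of_set {1..Suc n}"
    and max: "num_occurrences \<tau> \<sigma> = max_occurrences \<tau> (Suc n)"
    by (rule max_occurrences_attained)
  have dist: "distinct \<sigma>" and len: "length \<sigma> = Suc n"
    using \<sigma> distinct_card[of \<sigma>] by (auto simp: permutations_of_set_def)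
  have "(\<Sum>S\<in>occurrences \<tau> \<sigma>. card {i \<in> {..<Suc n}. i \<notin> S})
      = (\<Sum>S\<in>occurrences \<tau> \<sigma>. Suc n - length \<tau>)"
  proof (rule sum.cong[OF refl])
    fix S assume "S \<in> occurrences \<tau> \<sigma>"
    then have S: "S \<subseteq> {..<Suc n}" "card S = length \<tau>"
      by (auto simp: occurrences_def len)
    have "{i \<in> {..<Suc n}. i \<notin> S} = {..<Suc n} - S"
      by auto
    then show "card {i \<in> {..<Suc n}. i \<notin> S} = Suc n - length \<tau>"
      using S by (simp add: card_Diff_subset finite_subset)
  qed
  then have "(Suc n - length \<tau>) * max_occurrences \<tau> (Suc n)
      = (\<Sum>S\<in>occurrences \<tau> \<sigma>. card {i \<in> {..<Suc n}. i \<notin> S})"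
    by (simp add: max[symmetric] num_occurrences_def)
  also have "\<dots> = (\<Sum>i<Suc n. card {S \<in> occurrences \<tau> \<sigma>. i \<notin> S})"
    using finite_occurrences
    by (intro sum_multicount_gen) auto
  also have "\<dots> \<le> (\<Sum>i<Suc n. max_occurrences \<tau> n)"
  proof (rule sum_mono)
    fix i assume i: "i \<in> {..<Suc n}"
    have "{S \<in> occurrences \<tau> \<sigma>. i \<notin> S} = {S \<in> occurrences \<tau> \<sigma>. S \<subseteq> {..<Suc n} - {i}}"
      by (auto simp: occurrences_def len)
    then show "card {S \<in> occurrences \<tau> \<sigma>. i \<notin> S} \<le> max_occurrences \<tau> n"
      using card_occurrences_within_le[OF dist, of "{..<Suc n} - {i}" \<tau>] i len by auto
  qed
  finally show ?thesis
    by simp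
qed

lemma packing_ratio_Suc_le:
  assumes "length \<tau> \<le> n"
  shows "packing_ratio \<tau> (Suc n) \<le> packing_ratio \<tau> n"
proof -
  define m where "m = length \<tau>"
  have mn: "m \<le> n"
    using assms by (simp add: m_def)
  have "(Suc n - m) * (Suc n choose m) = Suc n * (n choose m)"
    using binomial_absorb_comp[of "Suc n" m] by simp
  then have eq: "real (Suc n - m) * real (Suc n choose m) = real (Suc n) * real (n choose m)"
    by (metis of_nat_mult)
  have le: "real (Suc n - m) * real (max_occurrences \<tau> (Suc n))
      \<le> real (Suc n) * real (max_occurrences \<tau> n)"
    using max_occurrences_Suc_le[of n \<tau>] unfolding m_def
    by (metis of_nat_le_iff of_nat_mult)
  have pos: "real (Suc n - m) > 0" "real (n choose m) > 0" "real (Suc n choose m) > 0"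
    using mn by auto
  have "packing_ratio \<tau> (Suc n)
      = (real (Suc n - m) * real (max_occurrences \<tau> (Suc n)))
        / (real (Suc n - m) * real (Suc n choose m))"
    using pos by (simp add: packing_ratio_def m_def)
  also have "\<dots> \<le> (real (Suc n) * real (max_occurrences \<tau> n)) / (real (Suc n) * real (n choose m))"
    unfolding eq by (intro divide_right_mono le) auto
  also have "\<dots> = packing_ratio \<tau> n"
    by (simp add: packing_ratio_def m_def del: of_nat_Suc)
  finally show ?thesis .
qed

lemma packing_ratio_LIMSEQ: "packing_ratio \<tau> \<longlonglongrightarrow> packing_density \<tau>"
proof -
  have "decseq (\<lambda>n. packing_ratio \<tau> (n + length \<tau>))"
    by (rule decseq_SucI) (simp add: packing_ratio_Suc_le)
  moreover have "0 \<le> packing_ratio \<tau> (n + length \<tau>)" for n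
    by (simp add: packing_ratio_def)
  ultimately obtain L where "(\<lambda>n. packing_ratio \<tau> (n + length \<tau>)) \<longlonglongrightarrow> L"
    using decseq_convergent[of _ 0] by blast
  then have "packing_ratio \<tau> \<longlonglongrightarrow> L"
    by (rule LIMSEQ_offset)
  then show ?thesis
    unfolding packing_density_def by (simp add: limI)
qed

end

theory Submission
  imports Defs
begin

text \<open>
  Order the positions of a permutation \<open>\<sigma>\<close> by \<open>R i j \<longleftrightarrow> i < j \<and> \<sigma> ! i < \<sigma> ! j\<close>. An occurrence of
  \<open>tau2 \<beta>\<close> is a chain of two points together with \<open>\<beta>\<close> pairwise incomparable points above it.
  Allow these \<open>\<beta>\<close> points to coincide and give the positions nonnegative weights, so that the
  number of copies becomes a polynomial in the weights. As in the Motzkin--Straus theorem, this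
  polynomial is convex along a transfer of weight between two incomparable points, because
  incomparable points of the pattern are twins; hence its maximum for a given total weight is
  attained on a chain. On a chain the polynomial is the sum over \<open>w\<close> of \<open>x w ^ \<beta>\<close> times the second
  elementary symmetric function of the weights below \<open>w\<close>. It is bounded by induction on the chain:
  let \<open>m\<close> be the weight of the top point and \<open>s\<close> the sum of the others. If \<open>s \<le> m\<close>, every other term
  is at most \<open>m ^ \<beta> * (x w)\<^sup>2 / 2\<close>, which is what the squares subtract from the top term, so
  \<open>m ^ \<beta> * s\<^sup>2 / 2\<close> remains; if \<open>m < s\<close>, the induction hypothesis leaves enough room as
  \<open>\<beta> \<ge> 3\<close>. The bound is attained asymptotically by an increasing sequence of relative length
  \<open>2 / (\<beta> + 2)\<close> followed by a decreasing one above it.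
\<close>

section \<open>Transferring weight between incomparable points\<close>

definition weight :: "('a \<Rightarrow> real) \<Rightarrow> 'a list \<Rightarrow> real" where
  "weight x l = (\<Prod>e\<leftarrow>l. x e)"

text \<open>Entries may repeat: if \<open>R\<close> and \<open>T\<close> are irreflexive, indices
  incomparable under \<open>T\<close> may share one point. On a chain this is what keeps copies
  possible at all.\<close>

definition copies :: "(nat \<Rightarrow> nat \<Rightarrow> bool) \<Rightarrow> ('a \<Rightarrow> 'a \<Rightarrow> bool) \<Rightarrow> nat \<Rightarrow> 'a set \<Rightarrow> 'a list set" where
  "copies T R m V =
     {l. set l \<subseteq> V \<and> length l = m \<and> (\<forall>i<m. \<forall>j<m. R (l ! i) (l ! j) \<longleftrightarrow> T i j)}"

lemma weight_nonneg: "(\<And>e. 0 \<le> x e) \<Longrightarrow> 0 \<le> weight x l"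
  unfolding weight_def by (induction l) auto

lemma finite_copies: "finite V \<Longrightarrow> finite (copies T R m V)"
  by (rule finite_subset[OF _ finite_lists_length_eq[of V m]]) (auto simp: copies_def)

text \<open>A single occurrence of \<open>u\<close> in \<open>l\<close> supplies the factor
  \<open>c\<close>; further occurrences cost nothing because \<open>c \<le> 1\<close>.\<close>

lemma weight_update_le:
  assumes "\<And>e. 0 \<le> x e" "0 \<le> c" "c \<le> 1" "0 \<le> s" "x u = c * s" "u \<in> set l"
  shows "weight x l \<le> c * weight (x(u := s)) l"
  using assms(6)
proof (induction l)
  case (Cons e l)
  have nn: "0 \<le> weight (x(u := s)) k" "0 \<le> weight x k" for k
    by (intro weight_nonneg; use assms in auto)+
  have le: "weight x k \<le> weight (x(u := s)) k" for k
  proof (induction k)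
    case (Cons d k)
    have "x d \<le> (x(u := s)) d"
      using assms by (auto intro: mult_left_le_one_le)
    with Cons show ?case
      using nn(2)[of k] assms unfolding weight_def by (auto intro!: mult_mono)
  qed (simp add: weight_def)
  show ?case
  proof (cases "e = u")
    case True
    then show ?thesis
      using le[of l] assms unfolding weight_def
      by (auto simp: mult.assoc intro!: mult_left_mono)
  next
    case False
    then have "u \<in> set l"
      using Cons.prems by simp
    then have "weight x l \<le> c * weight (x(u := s)) l"
      by (rule Cons.IH)
    then have "x e * weight x l \<le> x e * (c * weight (x(u := s)) l)"
      using assms(1) by (rule mult_left_mono)
    with False show ?thesis
      by (simp add: weight_def mult.left_commute)
  qed
qed simp

text \<open>A preimage of \<open>l\<close> is an independent choice of a preimage of each entry, so
  the sum is the expanded product.\<close>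

lemma sum_weight_fibre:
  assumes "finite V"
  shows "(\<Sum>l' | set l' \<subseteq> V \<and> map \<pi> l' = l. weight x l')
    = (\<Prod>e\<leftarrow>l. \<Sum>d | d \<in> V \<and> \<pi> d = e. x d)"
proof (induction l)
  case Nil
  have "{l'. set l' \<subseteq> V \<and> l' = []} = {[]}" by auto
  then show ?case by (simp add: weight_def)
next
  case (Cons e l)
  let ?A = "{d. d \<in> V \<and> \<pi> d = e}" and ?B = "{l'. set l' \<subseteq> V \<and> map \<pi> l' = l}"
  have "{l'. set l' \<subseteq> V \<and> map \<pi> l' = e # l} = (\<lambda>(d, l'). d # l') ` (?A \<times> ?B)"
    by (auto simp: image_iff map_eq_Cons_conv)
  moreover have "inj_on (\<lambda>(d, l'). d # l') (?A \<times> ?B)"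
    by (auto simp: inj_on_def)
  ultimately have "(\<Sum>l' | set l' \<subseteq> V \<and> map \<pi> l' = e # l. weight x l')
     = (\<Sum>(d, l')\<in>?A \<times> ?B. x d * weight x l')"
    by (simp add: sum.reindex weight_def case_prod_unfold)
  also have "\<dots> = (\<Sum>d\<in>?A. x d) * (\<Sum>l'\<in>?B. weight x l')"
    by (simp add: sum_product sum.cartesian_product)
  finally show ?case
    using Cons by simp
qed

text \<open>An index holding \<open>v\<close> and an index holding \<open>u\<close> are incomparable
  in \<open>T\<close>, hence twins, so reading one in place of the other preserves all
  relations.\<close>

lemma copies_map_twin:
  assumes twins: "\<And>i j k. i < m \<Longrightarrow> j < m \<Longrightarrow> k < m \<Longrightarrow> \<not> T i j \<Longrightarrow> \<not> T j i \<Longrightarrow>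
      (T i k \<longleftrightarrow> T j k) \<and> (T k i \<longleftrightarrow> T k j)"
    and l: "l \<in> copies T R m V" "u \<in> set l" "v \<in> set l"
    and R: "\<not> R u v" "\<not> R v u"
  shows "map (\<lambda>e. if e = v then u else e) l \<in> copies T R m V"
proof -
  let ?f = "\<lambda>e. if e = v then u else e"
  have len: "length l = m" and sub: "set l \<subseteq> V"
    and iff: "\<And>i j. i < m \<Longrightarrow> j < m \<Longrightarrow> R (l ! i) (l ! j) \<longleftrightarrow> T i j"
    using l(1) by (auto simp: copies_def)
  obtain p where p: "p < m" "l ! p = u"
    using l(2) len by (auto simp: in_set_conv_nth)
  \<comment> \<open>Every index holding \<open>v\<close> is redirected to one fixed index
    \<open>p\<close> holding \<open>u\<close>; the new list is \<open>l\<close> read along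
    \<open>q\<close>.\<close>
  define q where "q i = (if l ! i = v then p else i)" for i
  have q: "q i < m" "?f (l ! i) = l ! q i" if "i < m" for i
    using p that by (auto simp: q_def)
  have qT: "\<not> T i p \<and> \<not> T p i" if "i < m" "l ! i = v" for i
    using iff[of i p] iff[of p i] that p R by simp
  have T1: "T (q i) k \<longleftrightarrow> T i k" "T k (q i) \<longleftrightarrow> T k i" if "i < m" "k < m" for i k
    using twins[of i p k] qT[of i] that p(1) by (auto simp: q_def)
  have "R (?f (l ! i)) (?f (l ! j)) \<longleftrightarrow> T i j" if ij: "i < m" "j < m" for i j
    unfolding q(2)[OF ij(1)] q(2)[OF ij(2)]
    using iff[OF q(1)[OF ij(1)] q(1)[OF ij(2)]] T1(1)[OF ij(1) q(1)[OF ij(2)]]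
      T1(2)[OF ij(2,1)] by simp
  then show ?thesis
    using sub len l(2) by (auto simp: copies_def)
qed

text \<open>
  Moving all weight of two incomparable points onto one of them: the copies of \<open>T\<close> are grouped by
  the list in which \<open>v\<close> is replaced by \<open>u\<close>. A copy that uses both points stays a copy under
  either replacement, so each group is dominated by the convex combination.
\<close>

lemma sum_weight_copies_merge:
  assumes twins: "\<And>i j k. i < m \<Longrightarrow> j < m \<Longrightarrow> k < m \<Longrightarrow> \<not> T i j \<Longrightarrow> \<not> T j i \<Longrightarrow>
      (T i k \<longleftrightarrow> T j k) \<and> (T k i \<longleftrightarrow> T k j)"
    and V: "finite V" "u \<in> V" "v \<in> V" "u \<noteq> v"
    and R: "\<not> R u v" "\<not> R v u"
    and x: "\<And>e. 0 \<le> x e" "0 \<le> c" "c \<le> 1" "0 \<le> s" "x u = c * s" "x v = (1 - c) * s"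
  shows "(\<Sum>l\<in>copies T R m V. weight x l)
    \<le> c * (\<Sum>l\<in>copies T R m (V - {v}). weight (x(u := s)) l)
      + (1 - c) * (\<Sum>l\<in>copies T R m (V - {u}). weight (x(v := s)) l)"
proof -
  let ?f = "\<lambda>e. if e = v then u else e" and ?g = "\<lambda>e. if e = u then v else e"
  let ?C = "copies T R m V"
  \<comment> \<open>\<open>L\<close> contains the representatives of the groups: the fibres of
    \<open>map ?f\<close> over \<open>L\<close> partition the copies. \<open>map ?g\<close> gives
    the same representative with the roles of \<open>u\<close> and \<open>v\<close>
    exchanged.\<close>
  define L where "L = {l. set l \<subseteq> V - {v} \<and> length l = m}"
  define W where "W l = weight (x(u := s)) l" for l
  define I where "I P = (if P then 1 else 0 :: real)" for P
  have finL: "finite L"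
    unfolding L_def using V by (intro finite_lists_length_eq) auto
  have gf: "map ?g (map ?f l) = map ?g l" for l
    by auto
  have fg: "map ?f (map ?g l) = l" if "v \<notin> set l" for l
    using that by (induction l) auto
  have Wg: "weight (x(v := s)) (map ?g l) = W l" if "v \<notin> set l" for l
    using that V(4) unfolding W_def weight_def by (induction l) auto
  have fibre: "(\<Sum>l' | l' \<in> ?C \<and> map ?f l' = l. weight x l')
      \<le> c * (I (l \<in> ?C) * W l) + (1 - c) * (I (map ?g l \<in> ?C) * W l)" if l: "l \<in> L" for l
  proof -
    let ?F = "{l'. l' \<in> ?C \<and> map ?f l' = l}"
    have vl: "v \<notin> set l" and lV: "set l \<subseteq> V" and len: "length l = m"
      using l by (auto simp: L_def)
    define k where "k = map ?g l"
    \<comment> \<open>A copy in the fibre that avoids \<open>v\<close> is \<open>l\<close>, one that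
      avoids \<open>u\<close> is \<open>k\<close>; one that uses both makes \<open>l\<close> and
      \<open>k\<close> copies by the twin property.\<close>
    have cases: "l' \<in> ?C \<and> (l' = l \<or> l' = k \<or> (l \<in> ?C \<and> k \<in> ?C))" if "l' \<in> ?F" for l'
    proof -
      have l': "l' \<in> ?C" "map ?f l' = l"
        using that by auto
      have gl: "k = map ?g l'"
        unfolding k_def by (rule gf[of l', unfolded l'(2)])
      consider "v \<notin> set l'" | "u \<notin> set l'" | "u \<in> set l'" "v \<in> set l'"
        by auto
      then show ?thesis
      proof cases
        case 1
        then have "map ?f l' = l'"
          by (intro map_idI) auto
        then show ?thesis
          using l' by simp
      next
        case 2
        then have "map ?g l' = l'"
          by (intro map_idI) auto
        then show ?thesis
          using gl l'(1) by simp
      next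
        case 3
        have "map ?f l' \<in> ?C" "map ?g l' \<in> ?C"
          using copies_map_twin[OF twins l'(1) 3 R] copies_map_twin[OF twins l'(1) 3(2,1) R(2,1)]
          by blast+
        then show ?thesis
          using gl l' by simp
      qed
    qed
    \<comment> \<open>If only one of \<open>l\<close> and \<open>k\<close> is a copy, they differ,
      so \<open>u\<close> occurs in \<open>l\<close> and \<open>weight_update_le\<close> yields the
      factor \<open>c\<close> or \<open>1 - c\<close>.\<close>
    have moved: "k = l" if "u \<notin> set l"
      unfolding k_def using that by (intro map_idI) auto
    consider "l \<in> ?C" "k \<in> ?C" | "l \<in> ?C" "k \<notin> ?C"
      | "l \<notin> ?C" "k \<in> ?C" | "l \<notin> ?C" "k \<notin> ?C"
      by blast
    then show ?thesis
    proof cases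
      case 1
      have fin: "finite {l'. set l' \<subseteq> V \<and> map ?f l' = l}"
        by (rule finite_subset[OF _ finite_lists_length_eq[OF V(1), of m]]) (use len in auto)
      \<comment> \<open>Both coefficients are present, so \<open>W l\<close> must be reached. The
        fibre is enlarged to all lists over \<open>V\<close> that map to \<open>l\<close>; their
        total weight is exactly \<open>W l\<close> because \<open>x u + x v = s\<close>.\<close>
      have "(\<Sum>l'\<in>?F. weight x l') \<le> (\<Sum>l' | set l' \<subseteq> V \<and> map ?f l' = l. weight x l')"
        by (rule sum_mono2[OF fin]) (auto simp: copies_def x intro: weight_nonneg)
      also have "\<dots> = (\<Prod>e\<leftarrow>l. \<Sum>d | d \<in> V \<and> ?f d = e. x d)"
        by (rule sum_weight_fibre[OF V(1)])
      also have "\<dots> = (\<Prod>e\<leftarrow>l. (x(u := s)) e)"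
      proof (rule arg_cong[where f = prod_list], rule map_cong[OF refl])
        fix e assume e: "e \<in> set l"
        show "(\<Sum>d | d \<in> V \<and> ?f d = e. x d) = (x(u := s)) e"
        proof (cases "e = u")
          case True
          then have "{d. d \<in> V \<and> ?f d = e} = {u, v}"
            using V by auto
          then show ?thesis
            using True V(4) x by (simp add: algebra_simps)
        next
          case False
          then have "{d. d \<in> V \<and> ?f d = e} = {e}"
            using e vl lV by auto
          then show ?thesis
            using False by simp
        qed
      qed
      also have "\<dots> = W l"
        by (simp only: W_def weight_def)
      finally show ?thesis
        unfolding k_def[symmetric] using 1 by (simp add: I_def algebra_simps)
    next
      case 2
      then have "u \<in> set l"
        using moved by (metis (no_types))
      then have "weight x l \<le> c * W l"
        unfolding W_def by (intro weight_update_le x)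
      moreover have "?F \<subseteq> {l}"
      proof
        fix l' assume "l' \<in> ?F"
        from cases[OF this] 2 show "l' \<in> {l}"
          by auto
      qed
      then have "(\<Sum>l'\<in>?F. weight x l') \<le> (\<Sum>l'\<in>{l}. weight x l')"
        by (intro sum_mono2) (auto simp: x intro: weight_nonneg)
      ultimately show ?thesis
        unfolding k_def[symmetric] using 2 by (simp add: I_def)
    next
      case 3
      then have "u \<in> set l"
        using moved by (metis (no_types))
      then have "v \<in> set k"
        unfolding k_def by force
      then have "weight x k \<le> (1 - c) * weight (x(v := s)) k"
        using x by (intro weight_update_le) auto
      moreover have "?F \<subseteq> {k}"
      proof
        fix l' assume "l' \<in> ?F"
        from cases[OF this] 3 show "l' \<in> {k}"
          by auto
      qed
      then have "(\<Sum>l'\<in>?F. weight x l') \<le> (\<Sum>l'\<in>{k}. weight x l')"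
        by (intro sum_mono2) (auto simp: x intro: weight_nonneg)
      ultimately show ?thesis
        using 3 Wg[OF vl] unfolding k_def[symmetric] by (simp add: I_def)
    next
      case 4
      then have "?F = {}"
        using cases by (metis (no_types, lifting) ex_in_conv)
      then show ?thesis
        unfolding k_def[symmetric] \<open>?F = {}\<close> using 4 by (simp add: I_def)
    qed
  qed
  have inL: "map ?f ` ?C \<subseteq> L"
    using V by (auto simp: L_def copies_def)
  have "(\<Sum>l\<in>?C. weight x l) = (\<Sum>l\<in>L. \<Sum>l' | l' \<in> ?C \<and> map ?f l' = l. weight x l')"
    by (rule sum.group[OF finite_copies[OF V(1)] finL inL, symmetric])
  also have "\<dots> \<le> (\<Sum>l\<in>L. c * (I (l \<in> ?C) * W l) + (1 - c) * (I (map ?g l \<in> ?C) * W l))"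
    by (rule sum_mono[OF fibre])
  also have "\<dots> = c * (\<Sum>l\<in>L. I (l \<in> ?C) * W l) + (1 - c) * (\<Sum>l\<in>L. I (map ?g l \<in> ?C) * W l)"
    by (simp add: sum.distrib sum_distrib_left)
  also have "(\<Sum>l\<in>L. I (l \<in> ?C) * W l) = (\<Sum>l | l \<in> L \<and> l \<in> ?C. W l)"
    by (auto simp: I_def sum.inter_filter[OF finL] intro!: sum.cong)
  also have "{l. l \<in> L \<and> l \<in> ?C} = copies T R m (V - {v})"
    by (auto simp: L_def copies_def)
  also have "(\<Sum>l\<in>L. I (map ?g l \<in> ?C) * W l) = (\<Sum>l | l \<in> L \<and> map ?g l \<in> ?C. W l)"
    by (auto simp: I_def sum.inter_filter[OF finL] intro!: sum.cong)
  also have "\<dots> = (\<Sum>l | l \<in> L \<and> map ?g l \<in> ?C. weight (x(v := s)) (map ?g l))"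
    by (intro sum.cong refl Wg[symmetric]) (auto simp: L_def)
  also have "\<dots> = (\<Sum>l \<in> map ?g ` {l. l \<in> L \<and> map ?g l \<in> ?C}. weight (x(v := s)) l)"
  proof (rule sum.reindex[symmetric, unfolded o_def])
    show "inj_on (map ?g) {l. l \<in> L \<and> map ?g l \<in> ?C}"
      by (rule inj_on_inverseI[where g = "map ?f"], rule fg) (auto simp: L_def)
  qed
  also have "\<dots> \<le> (\<Sum>l\<in>copies T R m (V - {u}). weight (x(v := s)) l)"
  proof (rule sum_mono2)
    show "map ?g ` {l. l \<in> L \<and> map ?g l \<in> ?C} \<subseteq> copies T R m (V - {u})"
      using V(4) by (auto simp: copies_def split: if_splits)
  qed (use V x in \<open>auto intro!: weight_nonneg finite_copies\<close>)
  finally show ?thesis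
    using x(3) unfolding W_def by (simp only: add_left_mono mult_left_mono diff_ge_0_iff_ge)
qed

text \<open>Symmetrization in the style of Motzkin and Straus: while some pair is incomparable,
  merging it keeps the total weight, removes one point, and bounds the sum by a convex combination
  of two smaller instances. \<open>B\<close> sees only the total, so the chain bound
  survives.\<close>

lemma sum_weight_copies_le:
  assumes twins: "\<And>i j k. i < m \<Longrightarrow> j < m \<Longrightarrow> k < m \<Longrightarrow> \<not> T i j \<Longrightarrow> \<not> T j i \<Longrightarrow>
      (T i k \<longleftrightarrow> T j k) \<and> (T k i \<longleftrightarrow> T k j)"
    and chain: "\<And>V x. finite V \<Longrightarrow> (\<And>e. 0 \<le> x e) \<Longrightarrow>
      (\<And>u v. u \<in> V \<Longrightarrow> v \<in> V \<Longrightarrow> u \<noteq> v \<Longrightarrow> R u v \<or> R v u) \<Longrightarrow>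
      (\<Sum>l\<in>copies T R m V. weight x l) \<le> B (\<Sum>e\<in>V. x e)"
    and "finite V" "\<And>e. 0 \<le> x e"
  shows "(\<Sum>l\<in>copies T R m V. weight x l) \<le> B (\<Sum>e\<in>V. x e)"
  using assms(3,4)
proof (induction "card V" arbitrary: V x rule: less_induct)
  case less
  show ?case
  proof (cases "\<forall>u\<in>V. \<forall>v\<in>V. u \<noteq> v \<longrightarrow> R u v \<or> R v u")
    case True
    then show ?thesis
      using less by (intro chain) auto
  next
    case False
    then obtain u v where uv: "u \<in> V" "v \<in> V" "u \<noteq> v" "\<not> R u v" "\<not> R v u"
      by blast
    define s where "s = x u + x v"
    \<comment> \<open>For \<open>s = 0\<close> this gives \<open>c = 0\<close>, and both weights
      vanish, so \<open>xu\<close> and \<open>xv\<close> still hold.\<close>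
    define c where "c = x u / s"
    have x: "0 \<le> x e" for e
      using less by simp
    have s: "0 \<le> s"
      using x by (simp add: s_def)
    have zero: "x u = 0 \<and> x v = 0" if "s = 0"
      using that x[of u] x[of v] by (simp add: s_def add_nonneg_eq_0_iff)
    have xu: "x u = c * s"
      using zero by (auto simp: c_def)
    have xv: "x v = (1 - c) * s"
      using xu by (simp add: s_def algebra_simps)
    have c: "0 \<le> c" "c \<le> 1"
      using x[of u] x[of v] by (auto simp: c_def s_def divide_le_eq_1 intro: add_nonneg_nonneg)
    have sumx: "(\<Sum>e\<in>V - {b}. (x(a := s)) e) = (\<Sum>e\<in>V. x e)"
      if ab: "a \<in> V" "b \<in> V" "a \<noteq> b" "s = x a + x b" for a b
    proof -
      have a: "a \<in> V - {b}" and fin: "finite (V - {b})"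
        using ab less(2) by auto
      have "(\<Sum>e\<in>V. x e) = x b + (x a + (\<Sum>e\<in>V - {b} - {a}. x e))"
        using sum.remove[OF less(2) ab(2), of x] sum.remove[OF fin a, of x] by simp
      moreover have "(\<Sum>e\<in>V - {b} - {a}. (x(a := s)) e) = (\<Sum>e\<in>V - {b} - {a}. x e)"
        by (intro sum.cong) auto
      ultimately show ?thesis
        using sum.remove[OF fin a, of "x(a := s)"] ab(4) by simp
    qed
    have IH: "(\<Sum>l\<in>copies T R m (V - {b}). weight (x(a := s)) l) \<le> B (\<Sum>e\<in>V. x e)"
      if "a \<in> V" "b \<in> V" "a \<noteq> b" "s = x a + x b" for a b
    proof -
      have "(\<Sum>l\<in>copies T R m (V - {b}). weight (x(a := s)) l) \<le> B (\<Sum>e\<in>V - {b}. (x(a := s)) e)"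
        using less(2) that x s by (intro less(1) psubset_card_mono) auto
      then show ?thesis
        using sumx[OF that] by simp
    qed
    have "(\<Sum>l\<in>copies T R m V. weight x l)
      \<le> c * (\<Sum>l\<in>copies T R m (V - {v}). weight (x(u := s)) l)
      + (1 - c) * (\<Sum>l\<in>copies T R m (V - {u}). weight (x(v := s)) l)"
      by (rule sum_weight_copies_merge[OF twins less(2) uv x c s xu xv])
    also have "\<dots> \<le> c * B (\<Sum>e\<in>V. x e) + (1 - c) * B (\<Sum>e\<in>V. x e)"
      using c uv by (intro add_mono mult_left_mono IH) (auto simp: s_def)
    finally show ?thesis
      by (simp add: algebra_simps)
  qed
qed

section \<open>The inequality for chains\<close>

definition peak :: "nat \<Rightarrow> real" where
  "peak \<beta> = (2 / (real \<beta> + 2))\<^sup>2 * (real \<beta> / (real \<beta> + 2)) ^ \<beta>"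

lemma peak_nonneg: "0 \<le> peak \<beta>"
  by (simp add: peak_def)

text \<open>
  \<open>peak \<beta>\<close> is the maximum of \<open>t ^ \<beta> * (1 - t)\<^sup>2\<close> on the unit interval, attained at \<open>t = \<beta> / (\<beta> + 2)\<close>.
\<close>

lemma power_mult_square_le_peak:
  assumes "0 \<le> m" "0 \<le> s" "0 < \<beta>"
  shows "m ^ \<beta> * s\<^sup>2 \<le> peak \<beta> * (m + s) ^ (\<beta> + 2)"
proof (cases "m + s = 0")
  case True
  then show ?thesis
    using assms by (simp add: add_nonneg_eq_0_iff)
next
  case False
  define N where "N = m + s"
  \<comment> \<open>\<open>u\<close> and \<open>v\<close> are \<open>m\<close> and \<open>s\<close>
    divided by their values at the maximum for fixed sum \<open>N\<close>. The claim becomes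
    \<open>u ^ \<beta> * v\<^sup>2 \<le> 1\<close>, a weighted AM-GM inequality that follows from
    \<open>z \<le> exp (z - 1)\<close>.\<close>
  define u where "u = m * (\<beta> + 2) / (\<beta> * N)"
  define v where "v = s * (\<beta> + 2) / (2 * N)"
  have N: "0 < N"
    using False assms by (simp add: N_def)
  have uv: "0 \<le> u" "0 \<le> v"
    using assms N by (simp_all add: u_def v_def)
  have "\<beta> * u + 2 * v = m * (\<beta> + 2) / N + s * (\<beta> + 2) / N"
    using assms N by (simp add: u_def v_def)
  also have "\<dots> = (m + s) * (\<beta> + 2) / N"
    by (simp add: add_divide_distrib distrib_right)
  also have "\<dots> = \<beta> + 2"
    using N by (simp add: N_def)
  finally have sum: "\<beta> * (u - 1) + 2 * (v - 1) = 0"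
    by (simp add: algebra_simps)
  have "u ^ \<beta> * v\<^sup>2 \<le> exp (u - 1) ^ \<beta> * (exp (v - 1))\<^sup>2"
    using uv exp_ge_add_one_self[of "u - 1"] exp_ge_add_one_self[of "v - 1"]
    by (intro mult_mono power_mono) auto
  also have "\<dots> = exp (\<beta> * (u - 1) + 2 * (v - 1))"
    by (simp only: exp_add exp_of_nat_mult exp_double)
  finally have le: "u ^ \<beta> * v\<^sup>2 \<le> 1"
    using sum by simp
  have m: "m = u * (\<beta> / (real \<beta> + 2)) * N" and s: "s = v * (2 / (real \<beta> + 2)) * N"
    using assms N by (simp_all add: u_def v_def add.commute)
  have "m ^ \<beta> * s\<^sup>2 = (u ^ \<beta> * v\<^sup>2) * (peak \<beta> * N ^ (\<beta> + 2))"
    by (subst m, subst s) (simp only: peak_def power_mult_distrib power_add mult_ac)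
  also have "\<dots> \<le> 1 * (peak \<beta> * N ^ (\<beta> + 2))"
    using N peak_nonneg le by (intro mult_right_mono) auto
  finally show ?thesis
    by (simp add: N_def)
qed

text \<open>With \<open>\<beta> = n + 3\<close> the exponents are \<open>\<beta> + 2\<close> and
  \<open>\<beta>\<close>. Equality holds at \<open>r = 0\<close> and \<open>r = 1\<close>; this
  reduces the case of a light top point to \<open>r = 1\<close>.\<close>

lemma chord_power_le:
  fixes r :: real
  assumes "0 \<le> r" "r \<le> 1"
  shows "(2 ^ (n + 5) - 1) * r ^ (n + 3) \<le> (1 + r) ^ (n + 5) - 1"
proof (induction n)
  case 0
  \<comment> \<open>The difference of the two sides has the factors \<open>r\<close> and
    \<open>1 - r\<close>; this estimate makes the remaining cubic factor nonnegative.\<close>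
  have "6 * r\<^sup>2 + r ^ 3 \<le> 7 * r"
    using assms power_decreasing[of 1 2 r] power_decreasing[of 1 3 r] by simp
  then have "0 \<le> r * (1 - r) * (5 + 15 * r - 6 * r\<^sup>2 - r ^ 3)"
    using assms by (intro mult_nonneg_nonneg) auto
  also have "\<dots> = (1 + r) ^ 5 - 1 - 31 * r ^ 3"
    by algebra
  finally show ?case
    by simp
next
  case (Suc n)
  let ?M = "2 ^ (n + 5) - 1 :: real"
  have M: "1 \<le> (2::real) ^ (n + 5)"
    by (rule one_le_power) simp
  have p: "r ^ (n + 4) \<le> r ^ (n + 3)" "r ^ (n + 4) \<le> r"
    using assms power_decreasing[of "n + 3" "n + 4" r] power_decreasing[of 1 "n + 4" r] by auto
  have two: "(2::real) ^ (Suc n + 5) = 2 * 2 ^ (n + 5)"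
    by (metis add_Suc power_Suc)
  have e: "r ^ (n + 4) = r * r ^ (n + 3)"
    by (simp add: numeral_eq_Suc)
  have "(2 ^ (Suc n + 5) - 1) * r ^ (Suc n + 3) = (2 * ?M + 1) * r ^ (n + 4)"
    unfolding two by (simp add: algebra_simps)
  \<comment> \<open>One copy of \<open>?M * r ^ (n + 4)\<close> is raised to
    \<open>?M * r ^ (n + 3)\<close> and the stray \<open>r ^ (n + 4)\<close> to \<open>r\<close>,
    which produces the factor \<open>1 + r\<close> for the induction hypothesis.\<close>
  also have "\<dots> \<le> ?M * r ^ (n + 3) + ?M * r ^ (n + 4) + r"
    using mult_left_mono[OF p(1), of ?M] p(2) M by (simp add: algebra_simps)
  also have "\<dots> = (1 + r) * (?M * r ^ (n + 3)) + r"
    unfolding e by (simp only: ring_distribs mult_1 mult_ac)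
  also have "\<dots> \<le> (1 + r) * ((1 + r) ^ (n + 5) - 1) + r"
    using Suc assms by (intro add_mono mult_left_mono) auto
  also have "\<dots> = (1 + r) * (1 + r) ^ (n + 5) - 1"
    by (simp add: algebra_simps)
  also have "\<dots> = (1 + r) ^ (Suc n + 5) - 1"
    by (metis add_Suc power_Suc)
  finally show ?case .
qed

text \<open>This is the case \<open>m = s = 1\<close> of \<open>peak_add_le\<close>.
  \<open>peak \<beta>\<close> is bounded below by the value of
  \<open>t ^ \<beta> * (1 - t)\<^sup>2\<close> at \<open>t = 3 / 5\<close>, the maximizer for
  \<open>\<beta> = 3\<close>. For \<open>\<beta> = 2\<close> the right-hand side would be only
  15/16.\<close>

lemma peak_ge:
  assumes "3 \<le> \<beta>"
  shows "1 \<le> peak \<beta> * (2 ^ (\<beta> + 2) - 1)"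
proof -
  have num: "(5::real) ^ (\<beta> + 2) \<le> 3 ^ \<beta> * 2\<^sup>2 * (2 ^ (\<beta> + 2) - 1)"
    using assms
  proof (induction \<beta> rule: nat_induct_at_least)
    case (Suc n)
    have "(5::real) ^ (Suc n + 2) = 5 * 5 ^ (n + 2)"
      by simp
    also have "\<dots> \<le> 3 ^ n * 2\<^sup>2 * (5 * (2 ^ (n + 2) - 1))"
      using mult_left_mono[OF Suc(2), of 5] by (simp add: algebra_simps)
    also have "\<dots> \<le> 3 ^ n * 2\<^sup>2 * (3 * (2 ^ (Suc n + 2) - 1))"
    proof (rule mult_left_mono)
      have "1 \<le> (2::real) ^ n"
        by (rule one_le_power) simp
      then show "5 * (2 ^ (n + 2) - 1) \<le> 3 * (2 ^ (Suc n + 2) - (1::real))"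
        by simp
    qed simp
    finally show ?case
      by (simp add: algebra_simps)
  qed simp
  have one: "1 \<le> (2::real) ^ (\<beta> + 2)"
    by (rule one_le_power) simp
  have "5 ^ (\<beta> + 2) \<le> 3 ^ \<beta> * 2\<^sup>2 * (2 ^ (\<beta> + 2) - (1::real))"
    by (rule num)
  also have "\<dots> \<le> peak \<beta> * (3 + 2) ^ (\<beta> + 2) * (2 ^ (\<beta> + 2) - 1)"
    using assms one by (intro mult_right_mono power_mult_square_le_peak) auto
  finally have "5 ^ (\<beta> + 2) * 1 \<le> 5 ^ (\<beta> + 2) * (peak \<beta> * (2 ^ (\<beta> + 2) - 1))"
    by (simp add: mult_ac)
  then show ?thesis
    by (simp only: mult_le_cancel_left_pos zero_less_power zero_less_numeral)
qed

text \<open>The induction step for a top point of weight \<open>m\<close> below the sum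
  \<open>s\<close> of the others. After division by \<open>s ^ (\<beta> + 2)\<close> it follows from
  \<open>peak_ge\<close> and \<open>chord_power_le\<close> with \<open>r = m / s\<close>.\<close>

lemma peak_add_le:
  assumes "3 \<le> \<beta>" "0 \<le> m" "m \<le> s"
  shows "peak \<beta> * s ^ (\<beta> + 2) + m ^ \<beta> * s\<^sup>2 \<le> peak \<beta> * (m + s) ^ (\<beta> + 2)"
proof (cases "s = 0")
  case True
  then show ?thesis
    using assms by simp
next
  case False
  define r where "r = m / s"
  have s: "0 < s" and r: "0 \<le> r" "r \<le> 1" and m: "m = r * s"
    using assms False by (auto simp: r_def)
  obtain n where n: "\<beta> = n + 3"
    using assms(1) by (metis add.commute le_Suc_ex)
  then have n2: "\<beta> + 2 = n + 5"
    by simp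
  have "1 * r ^ \<beta> \<le> peak \<beta> * (2 ^ (\<beta> + 2) - 1) * r ^ \<beta>"
    using assms r by (intro mult_right_mono peak_ge) auto
  also have "\<dots> \<le> peak \<beta> * ((1 + r) ^ (\<beta> + 2) - 1)"
    using chord_power_le[OF r, of n] peak_nonneg[of \<beta>]
    unfolding mult.assoc n2 by (intro mult_left_mono) (simp_all add: n)
  finally have "(peak \<beta> + r ^ \<beta>) * s ^ (\<beta> + 2) \<le> peak \<beta> * (1 + r) ^ (\<beta> + 2) * s ^ (\<beta> + 2)"
    using s by (intro mult_right_mono) (auto simp: algebra_simps)
  also have "\<dots> = peak \<beta> * (m + s) ^ (\<beta> + 2)"
    by (simp add: m algebra_simps flip: power_mult_distrib)
  finally show ?thesis
    by (simp add: m power_mult_distrib power_add power2_eq_square algebra_simps)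
qed

text \<open>The difference of squares is twice the second elementary symmetric function of the
  weights below \<open>w\<close>, as in \<open>sum_pairs\<close>. In this form the subtracted
  squares are available to the induction on the top point.\<close>

lemma sum_chain_le:
  fixes x :: "'a::linorder \<Rightarrow> real"
  assumes "3 \<le> \<beta>" "finite V" "\<And>e. 0 \<le> x e"
  shows "(\<Sum>w\<in>V. x w ^ \<beta> * ((\<Sum>a | a \<in> V \<and> a < w. x a)\<^sup>2 - (\<Sum>a | a \<in> V \<and> a < w. (x a)\<^sup>2)))
    \<le> peak \<beta> * (\<Sum>a\<in>V. x a) ^ (\<beta> + 2)"
  using assms(2)
proof (induction V rule: finite_linorder_max_induct)
  case empty
  then show ?case by simp
next
  case (insert b A)
  define F where "F V = (\<Sum>w\<in>V. x w ^ \<beta> *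
    ((\<Sum>a | a \<in> V \<and> a < w. x a)\<^sup>2 - (\<Sum>a | a \<in> V \<and> a < w. (x a)\<^sup>2)))" for V
  define s where "s = (\<Sum>a\<in>A. x a)"
  define q where "q = (\<Sum>a\<in>A. (x a)\<^sup>2)"
  have bA: "b \<notin> A"
    using insert by auto
  have s: "0 \<le> s" and q: "0 \<le> q" and b: "0 \<le> x b"
    using assms(3) by (auto simp: s_def q_def intro: sum_nonneg)
  have below: "{a. a \<in> insert b A \<and> a < w} = {a. a \<in> A \<and> a < w}" if "w \<in> A" for w
    using insert that by force
  have "{a. a \<in> insert b A \<and> a < b} = A"
    using insert by auto
  moreover have "(\<Sum>w\<in>A. x w ^ \<beta> * ((\<Sum>a | a \<in> insert b A \<and> a < w. x a)\<^sup>2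
      - (\<Sum>a | a \<in> insert b A \<and> a < w. (x a)\<^sup>2))) = F A"
    unfolding F_def by (intro sum.cong refl) (simp only: below)
  ultimately have "F (insert b A) = x b ^ \<beta> * (s\<^sup>2 - q) + F A"
    unfolding F_def[of "insert b A"] sum.insert[OF insert.hyps(1) bA] by (simp only: s_def q_def)
  moreover have "F A + x b ^ \<beta> * (s\<^sup>2 - q) \<le> peak \<beta> * (x b + s) ^ (\<beta> + 2)"
  proof (cases "s \<le> x b")
    case True
    have "\<beta> - 2 + 2 = \<beta>"
      using assms(1) by simp
    then have split: "z ^ \<beta> = z ^ (\<beta> - 2) * z\<^sup>2" for z :: real
      by (metis power_add)
    \<comment> \<open>As \<open>x w \<le> s \<le> x b\<close>, the bracket is at most
      \<open>(x b)\<^sup>2\<close>, and \<open>\<beta> - 2\<close> of the factors \<open>x w\<close>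
      are traded for \<open>x b\<close>. The two factors \<open>x w\<close> that remain sum to
      \<open>q\<close>, which cancels the \<open>- q\<close> of the top term.\<close>
    have "F A \<le> (\<Sum>w\<in>A. x b ^ \<beta> * (x w)\<^sup>2)"
      unfolding F_def
    proof (rule sum_mono)
      fix w assume w: "w \<in> A"
      let ?L = "{a. a \<in> A \<and> a < w}"
      have fin: "finite ?L"
        using insert by simp
      have "x w + (\<Sum>a\<in>?L. x a) = (\<Sum>a\<in>insert w ?L. x a)"
        using fin by simp
      also have "\<dots> \<le> s"
        unfolding s_def using insert.hyps(1) w assms(3) by (intro sum_mono2) auto
      finally have le: "x w + (\<Sum>a\<in>?L. x a) \<le> s" .
      have nn: "0 \<le> (\<Sum>a\<in>?L. x a)" "0 \<le> (\<Sum>a\<in>?L. (x a)\<^sup>2)" "0 \<le> x w"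
        using assms(3) by (auto intro: sum_nonneg)
      have "x w ^ \<beta> * ((\<Sum>a\<in>?L. x a)\<^sup>2 - (\<Sum>a\<in>?L. (x a)\<^sup>2)) \<le> x w ^ \<beta> * (x b)\<^sup>2"
      proof (rule mult_left_mono)
        have "(\<Sum>a\<in>?L. x a)\<^sup>2 \<le> (x b)\<^sup>2"
          using le nn True by (intro power_mono) auto
        then show "(\<Sum>a\<in>?L. x a)\<^sup>2 - (\<Sum>a\<in>?L. (x a)\<^sup>2) \<le> (x b)\<^sup>2"
          using nn by simp
      qed (use nn in simp)
      also have "\<dots> = x w ^ (\<beta> - 2) * (x w)\<^sup>2 * (x b)\<^sup>2"
        by (simp only: split[of "x w"])
      also have "\<dots> \<le> x b ^ (\<beta> - 2) * (x w)\<^sup>2 * (x b)\<^sup>2"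
        using le nn True by (intro mult_right_mono power_mono) auto
      also have "\<dots> = x b ^ \<beta> * (x w)\<^sup>2"
        by (simp only: split[of "x b"] mult_ac)
      finally show "x w ^ \<beta> * ((\<Sum>a\<in>?L. x a)\<^sup>2 - (\<Sum>a\<in>?L. (x a)\<^sup>2)) \<le> x b ^ \<beta> * (x w)\<^sup>2" .
    qed
    also have "\<dots> = x b ^ \<beta> * q"
      by (simp add: q_def sum_distrib_left)
    finally have "F A + x b ^ \<beta> * (s\<^sup>2 - q) \<le> x b ^ \<beta> * s\<^sup>2"
      by (simp add: algebra_simps)
    also have "\<dots> \<le> peak \<beta> * (x b + s) ^ (\<beta> + 2)"
      using assms(1) s b by (intro power_mult_square_le_peak) auto
    finally show ?thesis .
  next
    case False
    \<comment> \<open>With a light top point the squares \<open>q\<close> can be discarded.\<close>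
    have "F A \<le> peak \<beta> * s ^ (\<beta> + 2)"
      using insert.IH by (simp add: F_def s_def)
    moreover have "x b ^ \<beta> * (s\<^sup>2 - q) \<le> x b ^ \<beta> * s\<^sup>2"
      using b q by (intro mult_left_mono) auto
    ultimately show ?thesis
      using peak_add_le[OF assms(1) b, of s] False by simp
  qed
  ultimately show ?case
    using insert.hyps(1) bA by (simp add: F_def s_def)
qed

section \<open>Pair sums, a binomial limit, and the bound on the number of copies\<close>

definition pairs :: "'a::linorder set \<Rightarrow> ('a \<times> 'a) set" where
  "pairs A = {(a, b). a \<in> A \<and> b \<in> A \<and> a < b}"

lemma finite_pairs: "finite A \<Longrightarrow> finite (pairs A)"
  by (rule finite_subset[of _ "A \<times> A"]) (auto simp: pairs_def)

lemma sum_pairs: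
  fixes x :: "'a::linorder \<Rightarrow> real"
  assumes "finite A"
  shows "2 * (\<Sum>(a, b)\<in>pairs A. x a * x b) = (\<Sum>a\<in>A. x a)\<^sup>2 - (\<Sum>a\<in>A. (x a)\<^sup>2)"
  using assms
proof (induction A rule: finite_linorder_max_induct)
  case empty
  then show ?case by (simp add: pairs_def)
next
  case (insert m A)
  have mA: "m \<notin> A"
    using insert by auto
  have "pairs (insert m A) = pairs A \<union> A \<times> {m}"
    using insert by (auto simp: pairs_def)
  moreover have "pairs A \<inter> A \<times> {m} = {}"
    using mA by (auto simp: pairs_def)
  ultimately have "(\<Sum>(a, b)\<in>pairs (insert m A). x a * x b)
    = (\<Sum>(a, b)\<in>pairs A. x a * x b) + (\<Sum>(a, b)\<in>A \<times> {m}. x a * x b)"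
    using insert.hyps(1) by (simp add: sum.union_disjoint finite_pairs)
  also have "(\<Sum>(a, b)\<in>A \<times> {m}. x a * x b) = (\<Sum>a\<in>A. x a) * x m"
    by (simp add: sum_distrib_right flip: sum.cartesian_product)
  finally show ?case
    using insert mA by (simp add: power2_eq_square algebra_simps)
qed

text \<open>The binomial coefficient is a product of \<open>m\<close> linear factors over
  \<open>fact m\<close>. Multiples \<open>c * k\<close> are used so that blocks in the ratio
  \<open>2 : \<beta>\<close> need no rounding.\<close>

lemma binomial_mult_limit:
  assumes "0 < c"
  shows "(\<lambda>k. real (c * k choose m) / real k ^ m) \<longlonglongrightarrow> real c ^ m / fact m"
proof -
  have "(\<lambda>k. (\<Prod>i = 0..<m. real c - real i / real k) / fact m)
      \<longlonglongrightarrow> (\<Prod>i = 0..<m. real c - 0) / fact m"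
    by (intro tendsto_intros lim_const_over_n) simp
  moreover have "\<forall>\<^sub>F k in sequentially. (\<Prod>i = 0..<m. real c - real i / real k) / fact m
      = real (c * k choose m) / real k ^ m"
    using eventually_gt_at_top[of 0]
  proof eventually_elim
    case (elim k)
    have "(\<Prod>i = 0..<m. real c - real i / real k) = (\<Prod>i = 0..<m. (real (c * k) - real i) / real k)"
      using elim by (intro prod.cong) (auto simp: field_simps)
    also have "\<dots> = (\<Prod>i = 0..<m. real (c * k) - real i) / real k ^ m"
      by (simp add: prod_dividef)
    finally show ?case
      by (simp add: binomial_gbinomial gbinomial_prod_rev field_simps)
  qed
  ultimately show ?thesis
    by (auto dest: Lim_transform_eventually)
qed

text \<open>On a chain the \<open>\<beta>\<close> pairwise incomparable entries must coincide, so a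
  copy is given by a point \<open>w\<close> and a pair \<open>a < b\<close> below it. The ordered
  pair accounts for the factor 1/2.\<close>

lemma sum_weight_copies_chain_le:
  fixes x :: "'a::linorder \<Rightarrow> real"
  assumes \<beta>: "3 \<le> \<beta>" and V: "finite V" and x: "\<And>e. 0 \<le> x e"
    and chain: "\<And>u v. u \<in> V \<Longrightarrow> v \<in> V \<Longrightarrow> u \<noteq> v \<Longrightarrow> R u v \<or> R v u"
    and R: "\<And>u v. R u v \<Longrightarrow> u < v"
  shows "(\<Sum>l\<in>copies (\<lambda>i j. i < 2 \<and> i < j) R (\<beta> + 2) V. weight x l)
    \<le> peak \<beta> / 2 * (\<Sum>e\<in>V. x e) ^ (\<beta> + 2)"
proof -
  let ?P = "\<lambda>w. pairs {a. a \<in> V \<and> a < w}"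
  let ?h = "\<lambda>(w, a, b). a # b # replicate \<beta> w"
  have fin: "finite (SIGMA w:V. ?P w)"
    using V by (intro finite_SigmaI finite_pairs) auto
  have sub: "copies (\<lambda>i j. i < 2 \<and> i < j) R (\<beta> + 2) V \<subseteq> ?h ` (SIGMA w:V. ?P w)"
  proof
    fix l assume "l \<in> copies (\<lambda>i j. i < 2 \<and> i < j) R (\<beta> + 2) V"
    then have lV: "set l \<subseteq> V" and len: "length l = \<beta> + 2"
      and iff: "\<And>i j. i < \<beta> + 2 \<Longrightarrow> j < \<beta> + 2 \<Longrightarrow> R (l ! i) (l ! j) \<longleftrightarrow> i < 2 \<and> i < j"
      by (auto simp: copies_def)
    have mem: "l ! i \<in> V" if "i < \<beta> + 2" for i
      using that len lV nth_mem[of i l] by auto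
    have lt: "l ! 0 < l ! 1" "l ! 1 < l ! 2"
      using iff[of 0 1] iff[of 1 2] \<beta> R by auto
    have eq: "l ! i = l ! 2" if "2 \<le> i" "i < \<beta> + 2" for i
      using iff[of i 2] iff[of 2 i] chain[OF mem mem, of i 2] that \<beta> by auto
    have "l = l ! 0 # l ! 1 # replicate \<beta> (l ! 2)"
    proof (rule nth_equalityI)
      fix i assume "i < length l"
      then show "l ! i = (l ! 0 # l ! 1 # replicate \<beta> (l ! 2)) ! i"
        using eq[of i] len by (cases i; cases "i - 1") (auto simp: numeral_2_eq_2)
    qed (simp add: len)
    moreover have "(l ! 2, l ! 0, l ! 1) \<in> (SIGMA w:V. ?P w)"
      using lt mem[of 0] mem[of 1] mem[of 2] \<beta> by (auto simp: pairs_def)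
    ultimately show "l \<in> ?h ` (SIGMA w:V. ?P w)"
      by (metis (mono_tags, lifting) case_prod_conv image_eqI)
  qed
  have "(\<Sum>l\<in>copies (\<lambda>i j. i < 2 \<and> i < j) R (\<beta> + 2) V. weight x l)
      \<le> (\<Sum>l\<in>?h ` (SIGMA w:V. ?P w). weight x l)"
    using fin sub x by (intro sum_mono2) (auto intro: weight_nonneg)
  also have "\<dots> \<le> (\<Sum>z\<in>(SIGMA w:V. ?P w). weight x (?h z))"
    using fin x by (intro sum_image_le[unfolded o_def]) (auto intro: weight_nonneg)
  also have "\<dots> = (\<Sum>(w, a, b)\<in>(SIGMA w:V. ?P w). x w ^ \<beta> * (x a * x b))"
    by (intro sum.cong) (auto simp: weight_def mult_ac)
  also have "\<dots> = (\<Sum>w\<in>V. x w ^ \<beta> * (\<Sum>(a, b)\<in>?P w. x a * x b))"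
    using V by (subst sum.Sigma[symmetric])
      (auto simp: sum_distrib_left case_prod_unfold intro: finite_pairs)
  also have "\<dots> = (\<Sum>w\<in>V. x w ^ \<beta> *
      ((\<Sum>a | a \<in> V \<and> a < w. x a)\<^sup>2 - (\<Sum>a | a \<in> V \<and> a < w. (x a)\<^sup>2))) / 2"
    unfolding sum_divide_distrib using V by (intro sum.cong) (auto simp flip: sum_pairs)
  also have "\<dots> \<le> peak \<beta> * (\<Sum>e\<in>V. x e) ^ (\<beta> + 2) / 2"
    by (intro divide_right_mono sum_chain_le \<beta> V x) simp
  finally show ?thesis
    by simp
qed

lemma card_copies_le:
  fixes V :: "'a::linorder set"
  assumes \<beta>: "3 \<le> \<beta>" and V: "finite V" and R: "\<And>u v. R u v \<Longrightarrow> u < v"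
  shows "real (card (copies (\<lambda>i j. i < 2 \<and> i < j) R (\<beta> + 2) V))
    \<le> peak \<beta> / 2 * real (card V) ^ (\<beta> + 2)"
proof -
  have "(\<Sum>l\<in>copies (\<lambda>i j. i < 2 \<and> i < j) R (\<beta> + 2) V. weight (\<lambda>_. 1) l)
      \<le> peak \<beta> / 2 * (\<Sum>e\<in>V. 1) ^ (\<beta> + 2)"
  proof (rule sum_weight_copies_le[where B = "\<lambda>s. peak \<beta> / 2 * s ^ (\<beta> + 2)"])
    fix V' :: "'a set" and x :: "'a \<Rightarrow> real"
    assume "finite V'" "\<And>e. 0 \<le> x e" "\<And>u v. u \<in> V' \<Longrightarrow> v \<in> V' \<Longrightarrow> u \<noteq> v \<Longrightarrow> R u v \<or> R v u"
    then show "(\<Sum>l\<in>copies (\<lambda>i j. i < 2 \<and> i < j) R (\<beta> + 2) V'. weight x l)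
        \<le> peak \<beta> / 2 * (\<Sum>e\<in>V'. x e) ^ (\<beta> + 2)"
      using \<beta> R by (intro sum_weight_copies_chain_le)
  \<comment> \<open>This includes the twin condition: two indices incomparable in the pattern are
    equal or both at least 2, and the latter lie above 0 and 1 and below nothing.\<close>
  qed (use V in auto)
  then show ?thesis
    by (simp add: weight_def map_replicate_const)
qed

section \<open>Occurrences in permutations\<close>

lemma nths_conv_map_filter: "nths xs S = map ((!) xs) (filter (\<lambda>i. i \<in> S) [0..<length xs])"
  by (induction xs rule: rev_induct) (auto simp: nths_append nth_append)

lemma sorted_wrt_nth_less_iff:
  fixes l :: "nat list"
  assumes "sorted_wrt (<) l" "i < length l" "j < length l"
  shows "l ! i < l ! j \<longleftrightarrow> i < j"
  using assms sorted_wrt_nth_less[of "(<)" l i j] sorted_wrt_nth_less[of "(<)" l j i]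
  by (cases i j rule: linorder_cases) auto

text \<open>For \<open>a \<le> n\<close>: the values 1 to \<open>a\<close> increasing, then
  \<open>n\<close> down to \<open>a + 1\<close>. One family contains both the pattern
  (\<open>a = 2\<close>) and the asymptotically optimal permutations.\<close>

definition hill :: "nat \<Rightarrow> nat \<Rightarrow> nat list" where
  "hill a n = map Suc ([0..<a] @ rev [a..<n])"

lemma tau2_eq_hill: "tau2 \<beta> = hill 2 (\<beta> + 2)"
proof -
  have "[0..<2] = [0, 1 :: nat]"
    by (simp add: upt_rec)
  moreover have "rev [3..<\<beta> + 3] = map Suc (rev [2..<\<beta> + 2])"
    by (simp add: map_Suc_upt numeral_eq_Suc flip: rev_map del: upt_Suc)
  ultimately show ?thesis
    by (simp add: tau2_def hill_def)
qed

lemma length_hill: "a \<le> n \<Longrightarrow> length (hill a n) = n"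
  by (simp add: hill_def)

lemma hill_in_permutations: "a \<le> n \<Longrightarrow> hill a n \<in> permutations_of_set {1..n}"
  by (auto simp: hill_def permutations_of_set_def distinct_map image_Un[symmetric] ivl_disj_un)

lemma hill_nth_less_iff:
  assumes "a \<le> n" "i < n" "j < n"
  shows "hill a n ! i < hill a n ! j \<longleftrightarrow> (if i < a then i < j else a \<le> j \<and> j < i)"
  using assms by (auto simp: hill_def nth_append rev_nth)

lemma length_tau2: "length (tau2 \<beta>) = \<beta> + 2"
  by (simp add: tau2_eq_hill length_hill)

text \<open>The last \<open>\<beta>\<close> positions of an occurrence are pairwise incomparable, so
  each of their \<open>fact \<beta>\<close> orderings is a copy.\<close>

lemma fact_mult_num_occurrences_le:
  fixes \<sigma> :: "nat list"
  defines "R \<equiv> \<lambda>i j. i < j \<and> \<sigma> ! i < \<sigma> ! j"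
  shows "fact \<beta> * num_occurrences (tau2 \<beta>) \<sigma>
    \<le> card (copies (\<lambda>i j. i < 2 \<and> i < j) R (\<beta> + 2) {..<length \<sigma>})"
proof -
  let ?O = "occurrences (tau2 \<beta>) \<sigma>"
  let ?C = "copies (\<lambda>i j. i < 2 \<and> i < j) R (\<beta> + 2) {..<length \<sigma>}"
  define pos where "pos S = filter (\<lambda>i. i \<in> S) [0..<length \<sigma>]" for S
  define Q where "Q S = permutations_of_set (set (drop 2 (pos S)))" for S
  have sorted: "sorted_wrt (<) (pos S)" for S
    unfolding pos_def by (intro sorted_wrt_filter sorted_wrt_upt)
  have dist: "distinct (pos S)" for S
    by (simp add: pos_def)
  have set: "set (pos S) = S" and len: "length (pos S) = \<beta> + 2"
    and iff: "\<And>i j. i < \<beta> + 2 \<Longrightarrow> j < \<beta> + 2 \<Longrightarrow> R (pos S ! i) (pos S ! j) \<longleftrightarrow> i < 2 \<and> i < j"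
    if S: "S \<in> ?O" for S
  proof -
    have S': "S \<subseteq> {..<length \<sigma>}" "card S = \<beta> + 2" "order_isomorphic (map ((!) \<sigma>) (pos S)) (tau2 \<beta>)"
      using S by (auto simp: occurrences_def length_tau2 nths_conv_map_filter pos_def)
    show "set (pos S) = S"
      using S'(1) by (auto simp: pos_def)
    then show len: "length (pos S) = \<beta> + 2"
      using S'(2) distinct_card[OF dist, of S] by simp
    show "R (pos S ! i) (pos S ! j) \<longleftrightarrow> i < 2 \<and> i < j" if "i < \<beta> + 2" "j < \<beta> + 2" for i j
      using S'(3) that len sorted_wrt_nth_less_iff[OF sorted, of i S j]
        hill_nth_less_iff[of 2 "\<beta> + 2" i j]
      by (auto simp: order_isomorphic_def R_def tau2_eq_hill split: if_splits)
  qed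
  have mem: "take 2 (pos S) @ p \<in> ?C" if S: "S \<in> ?O" and p: "p \<in> Q S" for S p
  proof -
    have ps: "set p = set (drop 2 (pos S))" and pd: "distinct p"
      using p by (auto simp: Q_def permutations_of_set_def)
    have pl: "length p = \<beta>"
      using distinct_card[OF pd] distinct_card[OF distinct_drop[OF dist, of 2 S]] ps len[OF S]
      by simp
    \<comment> \<open>Permuting the tail moves indices only among those from 2 on, which the pattern
      relation does not distinguish.\<close>
    have "\<exists>i'<\<beta> + 2. (take 2 (pos S) @ p) ! i = pos S ! i' \<and> (if i < 2 then i' = i else 2 \<le> i')"
      if i: "i < \<beta> + 2" for i
    proof (cases "i < 2")
      case True
      then show ?thesis
        using i len[OF S] by (auto simp: nth_append)
    next
      case False
      then have "p ! (i - 2) \<in> set (drop 2 (pos S))"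
        using i pl ps by (metis less_diff_conv2 linorder_not_less nth_mem)
      then obtain k where "k < \<beta>" "p ! (i - 2) = drop 2 (pos S) ! k"
        using len[OF S] by (auto simp: in_set_conv_nth)
      then show ?thesis
        using False len[OF S] by (intro exI[of _ "2 + k"]) (auto simp: nth_append numeral_2_eq_2)
    qed
    then obtain r where r: "\<And>i. i < \<beta> + 2 \<Longrightarrow> r i < \<beta> + 2 \<and>
        (take 2 (pos S) @ p) ! i = pos S ! r i \<and> (if i < 2 then r i = i else 2 \<le> r i)"
      by metis
    have "R ((take 2 (pos S) @ p) ! i) ((take 2 (pos S) @ p) ! j) \<longleftrightarrow> i < 2 \<and> i < j"
      if "i < \<beta> + 2" "j < \<beta> + 2" for i j
      using r[OF that(1)] r[OF that(2)] iff[OF S, of "r i" "r j"] by (auto split: if_splits)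
    moreover have "set (take 2 (pos S) @ p) \<subseteq> {..<length \<sigma>}"
      using ps by (auto simp: pos_def dest: in_set_takeD in_set_dropD)
    ultimately show ?thesis
      using len[OF S] pl by (simp add: copies_def)
  qed
  \<comment> \<open>The entries of the list recover \<open>S\<close>, and then its tail recovers
    \<open>p\<close>; hence the map from pairs to copies is injective.\<close>
  have union: "set (take 2 (pos S) @ p) = S" if "S \<in> ?O" "p \<in> Q S" for S p
    using set[OF that(1)] that(2) set_append[of "take 2 (pos S)" "drop 2 (pos S)"]
    by (simp add: Q_def permutations_of_set_def)
  have "fact \<beta> * num_occurrences (tau2 \<beta>) \<sigma> = (\<Sum>S\<in>?O. card (Q S))"
    using len by (simp add: Q_def num_occurrences_def distinct_card[OF distinct_drop[OF dist]])
  also have "\<dots> = card (SIGMA S:?O. Q S)"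
    by (simp add: finite_occurrences Q_def)
  also have "\<dots> \<le> card ?C"
  proof (rule card_inj_on_le)
    show "inj_on (\<lambda>(S, p). take 2 (pos S) @ p) (SIGMA S:?O. Q S)"
    proof (rule inj_onI, clarify)
      fix S p S' p'
      assume S: "S \<in> ?O" "p \<in> Q S" "S' \<in> ?O" "p' \<in> Q S'"
        and eq: "take 2 (pos S) @ p = take 2 (pos S') @ p'"
      have "S = S'"
        using union[OF S(1,2)] union[OF S(3,4)] eq by metis
      then show "S = S' \<and> p = p'"
        using eq by simp
    qed
    show "(\<lambda>(S, p). take 2 (pos S) @ p) ` (SIGMA S:?O. Q S) \<subseteq> ?C"
      using mem by auto
  qed (simp add: finite_copies)
  finally show ?thesis .
qed

section \<open>Upper and lower bounds for the maximal number of occurrences\<close>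

lemma fact_mult_max_occurrences_le:
  assumes "3 \<le> \<beta>"
  shows "fact \<beta> * real (max_occurrences (tau2 \<beta>) n) \<le> peak \<beta> / 2 * real n ^ (\<beta> + 2)"
proof -
  obtain \<sigma> where \<sigma>: "\<sigma> \<in> permutations_of_set {1..n}"
    and max: "num_occurrences (tau2 \<beta>) \<sigma> = max_occurrences (tau2 \<beta>) n"
    by (rule max_occurrences_attained)
  have len: "length \<sigma> = n"
    using \<sigma> distinct_card[of \<sigma>] by (auto simp: permutations_of_set_def)
  let ?C = "copies (\<lambda>i j. i < 2 \<and> i < j) (\<lambda>i j. i < j \<and> \<sigma> ! i < \<sigma> ! j) (\<beta> + 2) {..<n}"
  have "real (fact \<beta> * max_occurrences (tau2 \<beta>) n) \<le> real (card ?C)"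
    using fact_mult_num_occurrences_le[of \<beta> \<sigma>] unfolding max len by (rule of_nat_mono)
  also have "\<dots> \<le> peak \<beta> / 2 * real (card {..<n}) ^ (\<beta> + 2)"
    using assms by (intro card_copies_le) auto
  finally show ?thesis
    by simp
qed

text \<open>In \<open>hill a n\<close>, any two positions of the increasing part and any
  \<open>\<beta>\<close> of the decreasing part form an occurrence.\<close>

lemma binomial_mult_le_max_occurrences:
  assumes "a \<le> n"
  shows "(a choose 2) * (n - a choose \<beta>) \<le> max_occurrences (tau2 \<beta>) n"
proof -
  let ?X = "{A. A \<subseteq> {..<a} \<and> card A = 2}" and ?Y = "{B. B \<subseteq> {a..<n} \<and> card B = \<beta>}"
  have mem: "A \<union> B \<in> occurrences (tau2 \<beta>) (hill a n)" if A: "A \<in> ?X" and B: "B \<in> ?Y" for A B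
  proof -
    have fin: "finite A" "finite B"
      using A B by (auto intro: finite_subset)
    define k l where "k = filter (\<lambda>i. i \<in> A) [0..<a]" and "l = filter (\<lambda>i. i \<in> B) [a..<n]"
    have setk: "set k = A" and setl: "set l = B"
      using A B by (auto simp: k_def l_def)
    have "distinct k" "distinct l"
      by (simp_all add: k_def l_def)
    then have lenk: "length k = 2" and lenl: "length l = \<beta>"
      using A B distinct_card[of k] distinct_card[of l] setk setl by auto
    have "filter (\<lambda>i. i \<in> A \<union> B) [0..<n]
      = filter (\<lambda>i. i \<in> A \<union> B) [0..<a] @ filter (\<lambda>i. i \<in> A \<union> B) [a..<n]"
      using assms by (metis filter_append upt_add_eq_append zero_le le_add_diff_inverse)
    also have "filter (\<lambda>i. i \<in> A \<union> B) [0..<a] = k"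
      unfolding k_def using B by (intro filter_cong) auto
    also have "filter (\<lambda>i. i \<in> A \<union> B) [a..<n] = l"
      unfolding l_def using A by (intro filter_cong) auto
    finally have kl: "filter (\<lambda>i. i \<in> A \<union> B) [0..<n] = k @ l" .
    then have sorted: "sorted_wrt (<) (k @ l)"
      using sorted_wrt_filter[OF sorted_wrt_upt] by metis
    have small: "(k @ l) ! i < a \<longleftrightarrow> i < 2" and bound: "(k @ l) ! i < n" if "i < \<beta> + 2" for i
    proof -
      have "(k @ l) ! i \<in> (if i < 2 then A else B)"
        using that nth_mem[of i k] nth_mem[of "i - 2" l] by (auto simp: nth_append lenk lenl setk setl)
      then show "(k @ l) ! i < a \<longleftrightarrow> i < 2" "(k @ l) ! i < n"
        using A B assms by (auto split: if_splits)
    qed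
    have "order_isomorphic (map ((!) (hill a n)) (k @ l)) (hill 2 (\<beta> + 2))"
      unfolding order_isomorphic_def
    proof (intro conjI allI impI)
      fix i j
      assume "i < length (map ((!) (hill a n)) (k @ l))" "j < length (map ((!) (hill a n)) (k @ l))"
      then have ij: "i < \<beta> + 2" "j < \<beta> + 2"
        by (auto simp: lenk lenl)
      have "map ((!) (hill a n)) (k @ l) ! i < map ((!) (hill a n)) (k @ l) ! j
        \<longleftrightarrow> hill a n ! ((k @ l) ! i) < hill a n ! ((k @ l) ! j)"
        using ij by (simp add: lenk lenl del: map_append)
      also have "\<dots> \<longleftrightarrow> (if (k @ l) ! i < a then (k @ l) ! i < (k @ l) ! j
          else a \<le> (k @ l) ! j \<and> (k @ l) ! j < (k @ l) ! i)"
        using ij by (intro hill_nth_less_iff assms bound)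
      also have "\<dots> \<longleftrightarrow> (if i < 2 then i < j else 2 \<le> j \<and> j < i)"
        using ij small[of i] small[of j] sorted_wrt_nth_less_iff[OF sorted, of i j]
          sorted_wrt_nth_less_iff[OF sorted, of j i]
        by (auto simp: lenk lenl not_less[symmetric])
      also have "\<dots> \<longleftrightarrow> hill 2 (\<beta> + 2) ! i < hill 2 (\<beta> + 2) ! j"
        using ij by (intro hill_nth_less_iff[symmetric]) auto
      finally show "map ((!) (hill a n)) (k @ l) ! i < map ((!) (hill a n)) (k @ l) ! j
        \<longleftrightarrow> hill 2 (\<beta> + 2) ! i < hill 2 (\<beta> + 2) ! j" .
    qed (simp add: length_hill lenk lenl)
    moreover have "card (A \<union> B) = \<beta> + 2"
    proof -
      have "A \<inter> B = {}"
        using A B by force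
      then show ?thesis
        using A B fin by (simp add: card_Un_disjoint)
    qed
    ultimately show ?thesis
      using A B assms kl
      by (auto simp: occurrences_def nths_conv_map_filter length_hill tau2_eq_hill)
  qed
  have "inj_on (\<lambda>(A, B). A \<union> B) (?X \<times> ?Y)"
  proof (rule inj_on_inverseI)
    fix z assume "z \<in> ?X \<times> ?Y"
    then show "(\<lambda>S. (S \<inter> {..<a}, S \<inter> {a..<n})) ((\<lambda>(A, B). A \<union> B) z) = z"
      by fastforce
  qed
  then have "card (?X \<times> ?Y) \<le> num_occurrences (tau2 \<beta>) (hill a n)"
    unfolding num_occurrences_def using mem by (intro card_inj_on_le finite_occurrences) auto
  also have "\<dots> \<le> max_occurrences (tau2 \<beta>) n"
    using assms by (intro num_occurrences_le_max hill_in_permutations)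
  finally show ?thesis
    using n_subsets[of "{..<a}" 2] n_subsets[of "{a..<n}" \<beta>] by (simp add: card_cartesian_product)
qed

section \<open>The packing density as the common limit of both bounds\<close>

theorem corollary3p10:
  fixes \<beta> :: nat
  assumes "\<beta> \<ge> 3"
  shows "packing_density (tau2 \<beta>) =
    real ((\<beta> + 2) choose 2) * (2 / (real \<beta> + 2))\<^sup>2 * (real \<beta> / (real \<beta> + 2)) ^ \<beta>"
proof -
  have choose: "real ((\<beta> + 2) choose 2) = fact (\<beta> + 2) / (2 * fact \<beta>)"
    by (simp add: binomial_fact)
  have "packing_density (tau2 \<beta>) \<le> peak \<beta> / (2 * fact \<beta>) * fact (\<beta> + 2)"
  proof (rule LIMSEQ_le[OF packing_ratio_LIMSEQ])
    \<comment> \<open>The factor 1 matches \<open>binomial_mult_limit\<close> with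
      \<open>c = 1\<close>.\<close>
    have "(\<lambda>n. peak \<beta> / (2 * fact \<beta>) / (real (1 * n choose (\<beta> + 2)) / real n ^ (\<beta> + 2)))
      \<longlonglongrightarrow> peak \<beta> / (2 * fact \<beta>) / (real 1 ^ (\<beta> + 2) / fact (\<beta> + 2))"
      by (intro tendsto_divide tendsto_const binomial_mult_limit) auto
    then show "(\<lambda>n. peak \<beta> / (2 * fact \<beta>) / (real (1 * n choose (\<beta> + 2)) / real n ^ (\<beta> + 2)))
      \<longlonglongrightarrow> peak \<beta> / (2 * fact \<beta>) * fact (\<beta> + 2)"
      by simp
    show "\<exists>N. \<forall>n\<ge>N. packing_ratio (tau2 \<beta>) n
      \<le> peak \<beta> / (2 * fact \<beta>) / (real (1 * n choose (\<beta> + 2)) / real n ^ (\<beta> + 2))"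
    \<comment> \<open>The estimate holds from \<open>n = 0\<close> on: for
      \<open>n < \<beta> + 2\<close> the binomial coefficient is 0 and both sides are 0 by the
      convention for division.\<close>
    proof (intro exI allI impI)
      fix n :: nat assume "0 \<le> n"
      have "real (max_occurrences (tau2 \<beta>) n) \<le> peak \<beta> / (2 * fact \<beta>) * real n ^ (\<beta> + 2)"
        using fact_mult_max_occurrences_le[OF assms, of n] by (simp add: field_simps)
      then show "packing_ratio (tau2 \<beta>) n
        \<le> peak \<beta> / (2 * fact \<beta>) / (real (1 * n choose (\<beta> + 2)) / real n ^ (\<beta> + 2))"
        unfolding packing_ratio_def length_tau2 mult_1 divide_divide_eq_right
          by (rule divide_right_mono) simp
    qed
  qed
  moreover have "peak \<beta> / (2 * fact \<beta>) * fact (\<beta> + 2) \<le> packing_density (tau2 \<beta>)"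
  proof (rule LIMSEQ_le)
    \<comment> \<open>Hills of length \<open>(\<beta> + 2) * k\<close> with increasing part
      \<open>2 * k\<close> realize the optimal proportions; the powers of \<open>k\<close> cancel
      for \<open>k \<ge> 1\<close> and are inserted so that each factor converges.\<close>
    let ?f = "\<lambda>k. (real (2 * k choose 2) / real k ^ 2) * (real (\<beta> * k choose \<beta>) / real k ^ \<beta>)
      / (real ((\<beta> + 2) * k choose (\<beta> + 2)) / real k ^ (\<beta> + 2))"
    have "?f \<longlonglongrightarrow> (real 2 ^ 2 / fact 2) * (real \<beta> ^ \<beta> / fact \<beta>)
      / (real (\<beta> + 2) ^ (\<beta> + 2) / fact (\<beta> + 2))"
      using assms by (intro tendsto_divide tendsto_mult binomial_mult_limit) auto
    also have "(real 2 ^ 2 / fact 2) * (real \<beta> ^ \<beta> / fact \<beta>)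
      / (real (\<beta> + 2) ^ (\<beta> + 2) / fact (\<beta> + 2)) = peak \<beta> / (2 * fact \<beta>) * fact (\<beta> + 2)"
      unfolding peak_def power_add power_divide by (simp add: add.commute)
    finally show "?f \<longlonglongrightarrow> peak \<beta> / (2 * fact \<beta>) * fact (\<beta> + 2)" .
    show "(\<lambda>k. packing_ratio (tau2 \<beta>) ((\<beta> + 2) * k)) \<longlonglongrightarrow> packing_density (tau2 \<beta>)"
      by (intro LIMSEQ_subseq_LIMSEQ[OF packing_ratio_LIMSEQ, unfolded o_def] strict_monoI
          mult_strict_left_mono) auto
    show "\<exists>N. \<forall>k\<ge>N. ?f k \<le> packing_ratio (tau2 \<beta>) ((\<beta> + 2) * k)"
    proof (intro exI allI impI)
      fix k :: nat assume "1 \<le> k"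
      then have "?f k = real ((2 * k choose 2) * (\<beta> * k choose \<beta>)) / real ((\<beta> + 2) * k choose (\<beta> + 2))"
        by (simp add: power_add power2_eq_square)
      also have "(2 * k choose 2) * (\<beta> * k choose \<beta>) \<le> max_occurrences (tau2 \<beta>) ((\<beta> + 2) * k)"
        using binomial_mult_le_max_occurrences[of "2 * k" "(\<beta> + 2) * k" \<beta>]
        by (simp add: algebra_simps)
      finally show "?f k \<le> packing_ratio (tau2 \<beta>) ((\<beta> + 2) * k)"
        by (simp add: packing_ratio_def length_tau2 divide_right_mono)
    qed
  qed
  ultimately have eq: "packing_density (tau2 \<beta>) = peak \<beta> / (2 * fact \<beta>) * fact (\<beta> + 2)"
    by (rule antisym)
  show ?thesis
    unfolding eq choose peak_def by simp
qed

end
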